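(* Let $H_n=\sum_{k=1}^n\frac1k$ denote the $n$-th harmonic number (with $H_0=0$). Then $$\sum_{n=0}^\infty \frac{\binom{4n}{2n}}{2^{4n}}\,\frac{H_{n+1}}{n+1}=\frac{80}{9}-\frac{32\sqrt2}{9}-\frac{8\sqrt2}{3}\ln\!\left(\frac{1+\sqrt2}{2}\right).$$ *)

theory Defs
  imports "HOL-Analysis.Analysis"
begin

end

theory Submission
  imports Defs
begin

text \<open>Substituting \<open>x = y\<^sup>2\<close> in \<open>H\<^sub>n\<^sub>+\<^sub>1 / (n + 1) = - \<integral> x\<^sup>n ln (1 - x) dx\<close> over \<open>[0, 1]\<close>
  and summing under the integral turns the series into the integral over \<open>[0, 1]\<close> of
  \<open>- 2 y ln (1 - y\<^sup>2)\<close> times the even part \<open>(1 / sqrt (1 - y) + 1 / sqrt (1 + y)) / 2\<close> of the generating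
  function of the central binomial coefficients. This integrand has an elementary antiderivative that is
  continuous up to the end points. All terms are nonnegative, so the limit itself dominates the partial sums.\<close>

section \<open>Continuity of t ln t up to t = 0\<close>

lemma continuous_on_mult_ln:
  "continuous_on {0..} (\<lambda>x::real. x * ln x)"
  unfolding continuous_on_def
proof
  fix x :: real
  assume x: "x \<in> {0..}"
  show "((\<lambda>x. x * ln x) \<longlongrightarrow> x * ln x) (at x within {0..})"
  proof (cases "x = 0")
    case True
    have "((\<lambda>x::real. x * ln x) \<longlongrightarrow> 0) (at_right 0)"
    proof -
      \<comment> \<open>With z = 1/x, x ln x equals -(ln z / z), so the limit at 0 from the right is
        the known limit of ln z / z at infinity.\<close>
      have "((\<lambda>x::real. - (ln (inverse x) / inverse x)) \<longlongrightarrow> - 0) (at_right 0)"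
        by (intro tendsto_minus filterlim_compose[OF ln_x_over_x_tendsto_0 filterlim_inverse_at_top_right])
      then show ?thesis
        by (simp add: ln_inverse divide_inverse mult.commute)
    qed
    moreover have "at (0::real) within {0..} = at_right 0"
      by (rule at_within_nhd[of _ UNIV]) auto
    ultimately show ?thesis
      using True by simp
  next
    case False
    with x show ?thesis
      by (intro tendsto_intros) auto
  qed
qed

lemma continuous_on_mult_ln_comp:
  fixes f :: "'a::topological_space \<Rightarrow> real"
  assumes "continuous_on S f" "\<And>x. x \<in> S \<Longrightarrow> 0 \<le> f x"
  shows "continuous_on S (\<lambda>x. f x * ln (f x))"
  by (rule continuous_on_compose2[OF continuous_on_mult_ln assms(1)]) (use assms(2) in auto)

section \<open>Generating function of the central binomial coefficients\<close>

lemma gbinomial_minus_half: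
  "(- 1 / 2 :: real) gchoose n = (- 1) ^ n * real ((2 * n) choose n) / 4 ^ n"
proof (induction n)
  case (Suc n)
  \<comment> \<open>Both sides of the claim have successive ratio -(2n+1)/(2(n+1)). For the central
    binomials this is first stated over the naturals, free of division; the surplus factor n + 1 is
    cancelled over the reals.\<close>
  have "((2 * n) choose n) * (2 * n + 1) * (2 * n + 2) = (n + 1) * (n + 1) * ((2 * Suc n) choose Suc n)"
  proof -
    have 1: "(n + 1) * ((2 * Suc n) choose Suc n) = (2 * n + 2) * ((2 * n + 1) choose n)"
      using Suc_times_binomial_eq[of "2 * n + 1" n] by (simp add: algebra_simps)
    have 2: "(n + 1) * ((2 * n + 1) choose n) = (2 * n + 1) * ((2 * n) choose n)"
      using binomial_absorb_comp[of "2 * n + 1" n] by (simp add: algebra_simps)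
    have "(n + 1) * (n + 1) * ((2 * Suc n) choose Suc n)
            = (2 * n + 2) * ((n + 1) * ((2 * n + 1) choose n))"
      unfolding mult.assoc 1 by (rule mult.left_commute)
    then show ?thesis
      unfolding 2 by (simp only: ac_simps)
  qed
  then have "real (((2 * n) choose n) * (2 * n + 1) * (2 * n + 2))
      = real ((n + 1) * (n + 1) * ((2 * Suc n) choose Suc n))"
    by (rule arg_cong)
  then have "(real n + 1) * (real ((2 * Suc n) choose Suc n) * (real n + 1))
      = (real n + 1) * (2 * (2 * real n + 1) * real ((2 * n) choose n))"
    by (simp only: of_nat_mult of_nat_add of_nat_1 of_nat_numeral) (simp only: algebra_simps)
  then have *: "2 * (2 * real n + 1) * real ((2 * n) choose n)
      = real ((2 * Suc n) choose Suc n) * (real n + 1)"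
    by (simp only: mult_cancel_left) auto
  have "((- 1 / 2 :: real) gchoose Suc n) * (real n + 1) = ((- 1 / 2) gchoose n) * (- 1 / 2 - real n)"
    using gbinomial_mult_1[of "-1/2::real" n] by (simp add: algebra_simps)
  also have "\<dots> = (- 1) ^ Suc n / 4 ^ Suc n * (2 * (2 * real n + 1) * real ((2 * n) choose n))"
    unfolding Suc.IH by (simp add: field_simps)
  also have "\<dots> = (- 1) ^ Suc n * real ((2 * Suc n) choose Suc n) / 4 ^ Suc n * (real n + 1)"
    unfolding * by (simp only: times_divide_eq_left mult.assoc)
  finally show ?case
    by (simp only: mult_cancel_right) auto
qed simp

text \<open>Newton's binomial series with exponent -1/2, evaluated at -y: the two alternating signs
  cancel.\<close>

lemma central_binomial_sums:
  assumes "\<bar>y\<bar> < 1"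
  shows "(\<lambda>n. real ((2 * n) choose n) / 4 ^ n * y ^ n) sums (1 / sqrt (1 - y))"
proof -
  have "(\<lambda>n. ((- 1 / 2) gchoose n) * (- y) ^ n) sums ((1 + - y) powr (- 1 / 2))"
    using assms by (intro gen_binomial_real) auto
  also have "(\<lambda>n. ((- 1 / 2) gchoose n) * (- y) ^ n) = (\<lambda>n. real ((2 * n) choose n) / 4 ^ n * y ^ n)"
    unfolding gbinomial_minus_half power_minus[of y] by (simp add: fun_eq_iff)
  also have "(1 + - y) powr (- 1 / 2) = 1 / sqrt (1 - y)"
    using assms powr_minus[of "1 - y" "1 / 2"] by (simp add: powr_half_sqrt inverse_eq_divide)
  finally show ?thesis .
qed

text \<open>Averaging the series at y and -y cancels the odd terms, so only the even indices need to
  be kept.\<close>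

lemma even_central_binomial_sums:
  assumes "\<bar>y\<bar> < 1"
  shows "(\<lambda>n. real ((4 * n) choose (2 * n)) / 2 ^ (4 * n) * y ^ (2 * n))
           sums ((1 / sqrt (1 - y) + 1 / sqrt (1 + y)) / 2)"
proof -
  let ?f = "\<lambda>y n. real ((2 * n) choose n) / 4 ^ n * y ^ n"
  have "(\<lambda>n. (?f y n + ?f (- y) n) / 2) sums ((1 / sqrt (1 - y) + 1 / sqrt (1 - - y)) / 2)"
    using assms by (intro sums_divide sums_add central_binomial_sums) auto
  then have "(\<lambda>n. (?f y (2 * n) + ?f (- y) (2 * n)) / 2) sums ((1 / sqrt (1 - y) + 1 / sqrt (1 + y)) / 2)"
  proof (subst sums_mono_reindex[of "\<lambda>n. 2 * n"])
    fix n :: nat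
    assume "n \<notin> range (\<lambda>n. 2 * n)"
    then have "odd n"
      by (auto elim!: evenE)
    then show "(?f y n + ?f (- y) n) / 2 = 0"
      by simp
  qed (auto simp: strict_mono_def)
  also have "(\<lambda>n. (?f y (2 * n) + ?f (- y) (2 * n)) / 2)
      = (\<lambda>n. real ((4 * n) choose (2 * n)) / 2 ^ (4 * n) * y ^ (2 * n))"
    by (simp add: fun_eq_iff power_mult)
  finally show ?thesis .
qed

section \<open>Harmonic numbers as logarithmic integrals\<close>

lemma has_integral_power_ln:
  "((\<lambda>y::real. 2 * y * y ^ (2 * n) * - ln (1 - y\<^sup>2)) has_integral (harm (n + 1) / real (n + 1))) {0..1}"
proof -
  define Q :: "real \<Rightarrow> real" where "Q x = (\<Sum>k<Suc n. x ^ Suc k / real (Suc k))" for x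
  \<comment> \<open>Integration by parts of -x^n ln(1 - x), taking (x^(n+1) - 1)/(n+1) as primitive
    of x^n so that the factor vanishes at x = 1. Splitting 1 - x off that factor makes continuity at
    1 an instance of t ln t; \<open>P_alt\<close> is the form to differentiate.\<close>
  define P :: "real \<Rightarrow> real"
    where "P x = ((\<Sum>k<Suc n. x ^ k) * ((1 - x) * ln (1 - x)) + Q x) / real (n + 1)" for x
  have geom: "(\<Sum>k<Suc n. x ^ k) * (1 - x) = 1 - x ^ Suc n" for x :: real
    using one_diff_power_eq[of x "Suc n"] by (simp only: mult.commute)
  have P_alt: "P x = ((1 - x ^ Suc n) * ln (1 - x) + Q x) / real (n + 1)" for x
    unfolding P_def by (simp only: mult.assoc[symmetric] geom)
  have dP: "(P has_real_derivative (- (x ^ n) * ln (1 - x))) (at x)" if "x < 1" for x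
  proof -
    have dQ: "(Q has_real_derivative (\<Sum>k<Suc n. x ^ k)) (at x)"
      unfolding Q_def
    proof (intro DERIV_sum)
      fix k
      show "((\<lambda>x. x ^ Suc k / real (Suc k)) has_real_derivative x ^ k) (at x)"
        using DERIV_cdivide[OF DERIV_pow[of "Suc k" x], of "real (Suc k)"] by (simp del: of_nat_Suc power_Suc)
    qed
    have "(P has_real_derivative ((- (real (n + 1) * x ^ n) * ln (1 - x) - (1 - x ^ Suc n) / (1 - x)
          + (\<Sum>k<Suc n. x ^ k)) / real (n + 1))) (at x)"
      unfolding P_alt using that
      by (auto intro!: derivative_eq_intros dQ simp del: sum.lessThan_Suc power_Suc simp: divide_inverse)
    \<comment> \<open>The contribution of differentiating ln(1 - x) therefore cancels the derivative
      of \<open>Q\<close>.\<close>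
    also have "(1 - x ^ Suc n) / (1 - x) = (\<Sum>k<Suc n. x ^ k)"
      using geom[of x] that by (simp add: field_simps del: sum.lessThan_Suc power_Suc)
    finally show ?thesis
      by (simp del: sum.lessThan_Suc power_Suc of_nat_Suc of_nat_add)
  qed
  have "((\<lambda>y::real. 2 * y * y ^ (2 * n) * - ln (1 - y\<^sup>2)) has_integral (P (1\<^sup>2) - P (0\<^sup>2))) {0..1}"
  proof (rule fundamental_theorem_of_calculus_interior)
    show "continuous_on {0..1} (\<lambda>y. P (y\<^sup>2))"
      unfolding P_def Q_def by (intro continuous_intros continuous_on_mult_ln_comp) (auto simp: power_le_one)
    fix y :: real
    assume y: "y \<in> {0<..<1}"
    then have "y\<^sup>2 < 1"
      by (simp add: power_less_one_iff)
    then show "((\<lambda>y. P (y\<^sup>2)) has_vector_derivative 2 * y * y ^ (2 * n) * - ln (1 - y\<^sup>2)) (at y)"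
      unfolding has_real_derivative_iff_has_vector_derivative[symmetric] power_mult[of y 2 n]
      using DERIV_chain2[OF dP DERIV_pow[of 2 y]] by (simp add: mult_ac)
  qed simp
  also have "P (1\<^sup>2) - P (0\<^sup>2) = harm (n + 1) / real (n + 1)"
    unfolding P_def Q_def harm_def
    by (simp add: sum.atLeast1_atMost_eq inverse_eq_divide)
  finally show ?thesis .
qed

section \<open>The elementary antiderivative\<close>

text \<open>An antiderivative of \<open>- 2 (1 - u\<^sup>2) ln (u\<^sup>2 (2 - u\<^sup>2))\<close>, which is what
  \<open>y ln (1 - y\<^sup>2) / sqrt (1 - y) dy\<close> becomes under \<open>u = sqrt (1 - y)\<close>. The coefficients of the logarithms
  are factored so that continuity at \<open>u = 0\<close> and \<open>u = sqrt 2\<close> reduces to that of \<open>t ln t\<close>.\<close>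

definition log_primitive :: "real \<Rightarrow> real" where
  "log_primitive u = (2 * u ^ 3 / 3 - 2 * u - 2 * sqrt 2 / 3) * ln (sqrt 2 + u)
     - 2 / 3 * (u\<^sup>2 + sqrt 2 * u - 1) * ((sqrt 2 - u) * ln (sqrt 2 - u))
     + 4 * (u\<^sup>2 / 3 - 1) * (u * ln u) - 8 * u ^ 3 / 9 + 16 * u / 3"

lemma continuous_on_log_primitive: "continuous_on {0..sqrt 2} log_primitive"
  unfolding log_primitive_def [abs_def]
proof -
  have c: "continuous_on {0..sqrt 2} (\<lambda>u. u * ln u)"
    "continuous_on {0..sqrt 2} (\<lambda>u. (sqrt 2 - u) * ln (sqrt 2 - u))"
    by (rule continuous_on_mult_ln_comp; auto intro!: continuous_intros)+
  have d: "continuous_on {0..sqrt 2} (\<lambda>u. ln (sqrt 2 + u))"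
    by (intro continuous_intros) (auto simp: add_nonneg_eq_0_iff)
  show "continuous_on {0..sqrt 2} (\<lambda>u. (2 * u ^ 3 / 3 - 2 * u - 2 * sqrt 2 / 3) * ln (sqrt 2 + u)
     - 2 / 3 * (u\<^sup>2 + sqrt 2 * u - 1) * ((sqrt 2 - u) * ln (sqrt 2 - u))
     + 4 * (u\<^sup>2 / 3 - 1) * (u * ln u) - 8 * u ^ 3 / 9 + 16 * u / 3)"
    by (intro c d continuous_on_add continuous_on_diff continuous_on_mult continuous_on_divide
          continuous_on_power continuous_on_const continuous_on_id) auto
qed

text \<open>The arguments 0, 1 and sqrt 2 are the values of sqrt (1 - y) at y = 1, 0 and -1.\<close>

lemma log_primitive_0: "log_primitive 0 = 0"
  by (simp add: log_primitive_def)

lemma log_primitive_1: "log_primitive 1 = 40 / 9 - 4 * sqrt 2 / 3 * ln (1 + sqrt 2)"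
proof -
  have "(sqrt 2 - 1) * (1 + sqrt 2) = 1"
    by (simp add: algebra_simps)
  then have "sqrt 2 - 1 = inverse (1 + sqrt 2)"
    by (metis inverse_unique mult.commute)
  then have "ln (sqrt 2 - 1) = - ln (1 + sqrt 2)"
    by (simp add: ln_inverse)
  then show ?thesis
    by (simp add: log_primitive_def algebra_simps)
qed

lemma log_primitive_sqrt_2: "log_primitive (sqrt 2) = 32 * sqrt 2 / 9 - 8 * sqrt 2 / 3 * ln 2"
proof -
  have "ln (sqrt 2 + sqrt 2) = ln 2 + ln (sqrt 2)"
    using ln_mult[of 2 "sqrt 2"] by simp
  then show ?thesis
    by (simp add: log_primitive_def ln_sqrt power3_eq_cube algebra_simps)
qed

text \<open>The coefficients of the three logarithms differentiate to 2u^2 - 2, 2u^2 - 2 and 4u^2 -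
  4, which matches the factorization u^2 (2 - u^2) = u^2 (s + u)(s - u) with s = sqrt 2. All
  rational terms cancel.\<close>

lemma DERIV_log_primitive:
  assumes "0 < u" "u < sqrt 2"
  shows "(log_primitive has_real_derivative (- 2 * (1 - u\<^sup>2) * ln (u\<^sup>2 * (2 - u\<^sup>2)))) (at u)"
proof -
  define s where "s = sqrt 2"
  have s: "s * s = 2" "0 < s" "u < s"
    using assms by (auto simp: s_def)
  \<comment> \<open>Multiplied out, each logarithm has a single cubic as coefficient, ready for the
    product rule.\<close>
  have eq: "log_primitive = (\<lambda>u. (2 * u ^ 3 / 3 - 2 * u - 2 * s / 3) * ln (s + u)
     + (2 * u ^ 3 / 3 - 2 * u + 2 * s / 3) * ln (s - u)
     + (4 * u ^ 3 / 3 - 4 * u) * ln u - 8 * u ^ 3 / 9 + 16 * u / 3)" (is "_ = ?K")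
  proof
    fix u
    have *: "2 / 3 * (u\<^sup>2 + s * u - 1) * (s - u) = - (2 * u ^ 3 / 3 - 2 * u + 2 * s / 3)"
      using s(1) by (simp add: field_simps power2_eq_square power3_eq_cube)
    have "2 / 3 * (u\<^sup>2 + s * u - 1) * ((s - u) * ln (s - u)) = - ((2 * u ^ 3 / 3 - 2 * u + 2 * s / 3) * ln (s - u))"
      by (simp only: * mult_minus_left flip: mult.assoc)
    moreover have "4 * (u\<^sup>2 / 3 - 1) * (u * ln u) = (4 * u ^ 3 / 3 - 4 * u) * ln u"
      by (simp add: algebra_simps power2_eq_square power3_eq_cube)
    ultimately show "log_primitive u = ?K u"
      unfolding log_primitive_def s_def[symmetric] by (simp only: diff_minus_eq_add)
  qed
  have ln_eq: "ln (u\<^sup>2 * (2 - u\<^sup>2)) = 2 * ln u + ln (s + u) + ln (s - u)"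
  proof -
    have "u\<^sup>2 * (2 - u\<^sup>2) = u * u * ((s + u) * (s - u))"
      using s(1) by (simp add: algebra_simps power2_eq_square)
    also have "ln \<dots> = 2 * ln u + ln (s + u) + ln (s - u)"
      using assms(1) s by (simp add: ln_mult)
    finally show ?thesis .
  qed
  \<comment> \<open>The constants -2s/3 and 2s/3 make the first two cubics divisible by s + u and s
    - u, so every quotient is a polynomial; the terms -8u^3/9 + 16u/3 are chosen to cancel their
    sum.\<close>
  have rat: "(2 * u ^ 3 / 3 - 2 * u - 2 * s / 3) / (s + u) - (2 * u ^ 3 / 3 - 2 * u + 2 * s / 3) / (s - u)
     + (4 * u ^ 3 / 3 - 4 * u) / u - 8 * u\<^sup>2 / 3 + 16 / 3 = 0"
  proof -
    have "(2 * u ^ 3 / 3 - 2 * u - 2 * s / 3) / (s + u) = 2 / 3 * (u\<^sup>2 - s * u - 1)"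
    proof (subst nonzero_divide_eq_eq)
      show "2 * u ^ 3 / 3 - 2 * u - 2 * s / 3 = 2 / 3 * (u\<^sup>2 - s * u - 1) * (s + u)"
        using s(1) by (simp add: field_simps power2_eq_square power3_eq_cube)
    qed (use assms s in auto)
    moreover have "(2 * u ^ 3 / 3 - 2 * u + 2 * s / 3) / (s - u) = - (2 / 3) * (u\<^sup>2 + s * u - 1)"
    proof (subst nonzero_divide_eq_eq)
      show "2 * u ^ 3 / 3 - 2 * u + 2 * s / 3 = - (2 / 3) * (u\<^sup>2 + s * u - 1) * (s - u)"
        using s(1) by (simp add: field_simps power2_eq_square power3_eq_cube)
    qed (use assms s in auto)
    moreover have "(4 * u ^ 3 / 3 - 4 * u) / u = 4 * u\<^sup>2 / 3 - 4"
      using assms by (simp add: field_simps power2_eq_square power3_eq_cube)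
    ultimately show ?thesis
      by (simp add: field_simps)
  qed
  have poly: "((\<lambda>u. 2 * u ^ 3 / 3 - 2 * u - 2 * s / 3) has_real_derivative (2 * u\<^sup>2 - 2)) (at u)"
    "((\<lambda>u. 2 * u ^ 3 / 3 - 2 * u + 2 * s / 3) has_real_derivative (2 * u\<^sup>2 - 2)) (at u)"
    "((\<lambda>u. 4 * u ^ 3 / 3 - 4 * u) has_real_derivative (4 * u\<^sup>2 - 4)) (at u)"
    "((\<lambda>u. 8 * u ^ 3 / 9) has_real_derivative (8 * u\<^sup>2 / 3)) (at u)"
    "((\<lambda>u. 16 * u / 3) has_real_derivative (16 / 3)) (at u)"
    by (auto intro!: derivative_eq_intros)
  have log: "((\<lambda>u. ln (s + u)) has_real_derivative (1 / (s + u))) (at u)"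
    "((\<lambda>u. ln (s - u)) has_real_derivative (- 1 / (s - u))) (at u)"
    "(ln has_real_derivative (1 / u)) (at u)"
    using assms(1) s by (auto intro!: derivative_eq_intros)
  have "(?K has_real_derivative
      ((2 * u\<^sup>2 - 2) * ln (s + u) + (2 * u\<^sup>2 - 2) * ln (s - u) + (4 * u\<^sup>2 - 4) * ln u
       + ((2 * u ^ 3 / 3 - 2 * u - 2 * s / 3) / (s + u) - (2 * u ^ 3 / 3 - 2 * u + 2 * s / 3) / (s - u)
     + (4 * u ^ 3 / 3 - 4 * u) / u - 8 * u\<^sup>2 / 3 + 16 / 3))) (at u)"
    by (rule DERIV_cong[OF DERIV_add[OF DERIV_diff[OF DERIV_add[OF DERIV_add[OF DERIV_mult[OF poly(1) log(1)]
            DERIV_mult[OF poly(2) log(2)]] DERIV_mult[OF poly(3) log(3)]] poly(4)] poly(5)]])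
       simp
  then show ?thesis
    unfolding eq rat ln_eq by (simp add: algebra_simps)
qed

text \<open>Chain rule with y = 1 - u^2 and 1 - y^2 = u^2 (2 - u^2). Negative y is included because
  the result is also applied at -y.\<close>

lemma DERIV_log_primitive_sqrt:
  assumes "\<bar>y\<bar> < 1"
  shows "((\<lambda>y. log_primitive (sqrt (1 - y))) has_real_derivative (y * ln (1 - y\<^sup>2) / sqrt (1 - y))) (at y)"
proof -
  define u where "u = sqrt (1 - y)"
  have u: "0 < u" "u < sqrt 2" "u\<^sup>2 = 1 - y"
    using assms by (auto simp: u_def)
  have du: "((\<lambda>y. sqrt (1 - y)) has_real_derivative (- 1 / (2 * u))) (at y)"
  proof -
    have "((\<lambda>y. sqrt (1 - y)) has_real_derivative (inverse (sqrt (1 - y)) / 2 * - 1)) (at y)"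
      using assms by (intro DERIV_chain2[OF DERIV_real_sqrt]) (auto intro!: derivative_eq_intros)
    then show ?thesis
      by (simp add: u_def inverse_eq_divide mult.commute)
  qed
  have "((\<lambda>y. log_primitive (sqrt (1 - y))) has_real_derivative
      ((- 2 * (1 - u\<^sup>2) * ln (u\<^sup>2 * (2 - u\<^sup>2))) * (- 1 / (2 * u)))) (at y)"
    using DERIV_chain2[OF DERIV_log_primitive[OF u(1,2)[unfolded u_def]] du] unfolding u_def .
  also have "(- 2 * (1 - u\<^sup>2) * ln (u\<^sup>2 * (2 - u\<^sup>2))) * (- 1 / (2 * u)) = y * ln (1 - y\<^sup>2) / u"
    unfolding u(3) by (simp add: algebra_simps power2_eq_square)
  finally show ?thesis
    unfolding u_def .
qed

lemma has_integral_generating_function: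
  "((\<lambda>y. y * (1 / sqrt (1 - y) + 1 / sqrt (1 + y)) * - ln (1 - y\<^sup>2)) has_integral
      (80 / 9 - 32 * sqrt 2 / 9 - 8 * sqrt 2 / 3 * ln ((1 + sqrt 2) / 2))) {0..1}"
proof -
  \<comment> \<open>With f(y) = y ln(1 - y^2) / sqrt (1 - y), the integrand is -f(y) + f(-y), so
    reflecting the antiderivative handles the term with sqrt (1 + y).\<close>
  define G where "G y = - log_primitive (sqrt (1 - y)) - log_primitive (sqrt (1 - - y))" for y
  have "((\<lambda>y. y * (1 / sqrt (1 - y) + 1 / sqrt (1 + y)) * - ln (1 - y\<^sup>2)) has_integral (G 1 - G 0)) {0..1}"
  proof (rule fundamental_theorem_of_calculus_interior)
    show "continuous_on {0..1} G"
      unfolding G_def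
      by (intro continuous_intros continuous_on_compose2[OF continuous_on_log_primitive]) auto
    fix y :: real
    assume "y \<in> {0<..<1}"
    then have y: "\<bar>y\<bar> < 1" "\<bar>- y\<bar> < 1"
      by auto
    have "(G has_real_derivative (- (y * ln (1 - y\<^sup>2) / sqrt (1 - y))
        - (- y * ln (1 - (- y)\<^sup>2) / sqrt (1 - - y)) * - 1)) (at y)"
      unfolding G_def
      by (intro DERIV_diff DERIV_minus DERIV_log_primitive_sqrt[OF y(1)]
            DERIV_chain2[where f = "\<lambda>y. log_primitive (sqrt (1 - y))" and g = uminus, OF DERIV_log_primitive_sqrt[OF y(2)]])
         (auto intro!: derivative_eq_intros)
    then show "(G has_vector_derivative y * (1 / sqrt (1 - y) + 1 / sqrt (1 + y)) * - ln (1 - y\<^sup>2)) (at y)"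
      unfolding has_real_derivative_iff_has_vector_derivative[symmetric]
      by (simp add: algebra_simps)
  qed simp
  \<comment> \<open>This difference is twice the value of \<open>log_primitive\<close> at 1 minus
    its values at 0 and sqrt 2.\<close>
  also have "G 1 - G 0 = 80 / 9 - 32 * sqrt 2 / 9 - 8 * sqrt 2 / 3 * ln ((1 + sqrt 2) / 2)"
    by (simp add: G_def log_primitive_0 log_primitive_1 log_primitive_sqrt_2 ln_div add_pos_pos pos_add_strict
        less_imp_neq[symmetric] field_simps)
  finally show ?thesis .
qed

section \<open>Interchange of summation and integration\<close>

theorem theorem17:
  shows "(\<lambda>n::nat. real ((4 * n) choose (2 * n)) / 2 ^ (4 * n) * (harm (n + 1) / real (n + 1)))
           sums (80 / 9 - 32 * sqrt 2 / 9 - 8 * sqrt 2 / 3 * ln ((1 + sqrt 2) / 2))"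
proof -
  define a where "a n = real ((4 * n) choose (2 * n)) / 2 ^ (4 * n)" for n :: nat
  define g where "g y = y * (1 / sqrt (1 - y) + 1 / sqrt (1 + y)) * - ln (1 - y\<^sup>2)" for y :: real
  define t where "t n y = a n * (2 * y * y ^ (2 * n) * - ln (1 - y\<^sup>2))" for n and y :: real
  let ?S = "80 / 9 - 32 * sqrt 2 / 9 - 8 * sqrt 2 / 3 * ln ((1 + sqrt 2) / 2)"
  have g: "(g has_integral ?S) {0..1}"
    unfolding g_def by (rule has_integral_generating_function)
  have t: "((\<lambda>y. \<Sum>n<N. t n y) has_integral (\<Sum>n<N. a n * (harm (n + 1) / real (n + 1)))) {0..1}" for N
    unfolding t_def by (intro has_integral_sum has_integral_mult_right has_integral_power_ln) auto
  have t_sums: "(\<lambda>n. t n y) sums g y" if "y \<in> {0..1}" for y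
  proof (cases "y = 1")
    \<comment> \<open>Here y is on the boundary of the disc of convergence; since
      \<open>ln 0 = 0\<close>, every term and the limit are 0.\<close>
    case True
    then show ?thesis
      by (simp add: t_def g_def)
  next
    case False
    with that have "\<bar>y\<bar> < 1"
      by auto
    from sums_mult[OF even_central_binomial_sums[OF this], of "2 * y * - ln (1 - y\<^sup>2)"]
    show ?thesis
      unfolding t_def a_def g_def by (simp add: algebra_simps diff_divide_distrib)
  qed
  have t_nonneg: "0 \<le> t n y" if "y \<in> {0..1}" for n y
  proof -
    have "ln (1 - y\<^sup>2) \<le> 0"
      using that by (cases "y = 1") (auto simp: power_less_one_iff)
    then show ?thesis
      using that unfolding t_def a_def by (intro mult_nonneg_nonneg) auto
  qed
  have "norm (\<Sum>n<N. t n y) \<le> g y" if "y \<in> {0..1}" for N y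
  proof -
    have "(\<Sum>n<N. t n y) \<le> (\<Sum>n. t n y)"
      using t_sums[OF that] t_nonneg[OF that] by (intro sum_le_suminf) (auto simp: sums_iff)
    then show ?thesis
      using t_sums[OF that] t_nonneg[OF that] by (simp add: sum_nonneg sums_iff)
  qed
  \<comment> \<open>By \<open>t\<close>, the integrals on the left are the partial sums of the
    series, so their limit is its sum.\<close>
  then have "(\<lambda>N. integral {0..1} (\<lambda>y. \<Sum>n<N. t n y)) \<longlonglongrightarrow> integral {0..1} g"
    using t g t_sums by (intro dominated_convergence(2)[where h = g]) (auto simp: sums_def)
  then show ?thesis
    unfolding integral_unique[OF t] integral_unique[OF g] by (simp add: sums_def a_def)
qed

end
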